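(* Let $E,A\in\mathbb{R}^{n\times n}$ and $B\in\mathbb{R}^{n\times m}$, where $B$ has full column rank and $(E,A,B)$ is S-controllable. Let $B=Q\begin{bmatrix}R\\0\end{bmatrix}=Q_1R$ be the QR factorization of $B$, with $Q=[\,Q_1\ \ Q_2\,]\in\mathbb{R}^{n\times n}$ orthogonal, $Q_1\in\mathbb{R}^{n\times m}$, $Q_2\in\mathbb{R}^{n\times(n-m)}$ and $R\in\mathbb{R}^{m\times m}$ nonsingular upper triangular. Put $q=\operatorname{rank}([\,E\ \ B\,])$ and let $r$ be an integer with $q-m\le r\le q$. Let $l=n-\operatorname{rank}(Q_2^\top E)$ and let $Z\in\mathbb{R}^{n\times l}$ have orthonormal columns that span $\mathcal{N}(Q_2^\top E)$. Assume that $j$ infinite poles, $0\le j\le n-r-1$, have already been assigned (in the sense defined in the context), with $P_j=[\,p_1\ \cdots\ p_j\,]=ZW_j$, where $W_j\in\mathbb{R}^{l\times j}$ satisfies $W_j^\top W_j=I_j$, and $Q_2^\top X_j=Q_2^\top[\,x_1\ \cdots\ x_j\,]\in\mathbb{R}^{(n-m)\times j}$ computed. Define $$M=\begin{bmatrix} Q_2^\top AZ & -Q_2^\top & -Q_2^\top X_j\\ W_j^\top & 0 & 0\end{bmatrix}\in\mathbb{R}^{(n-m+j)\times(l+n+j)}.$$ Then: (a) $\dim(\mathcal{N}(M))=m+l$; and (b) there exist a nonzero $w\in\mathbb{R}^l$, and $x\in\mathbb{R}^n$, $v_S\in\mathbb{R}^j$, such that $[\,w^\top\ \ x^\top\ \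 v_S^\top\,]^\top\in\mathcal{N}(M)$.
   Context: $\mathcal{N}(\cdot)$ denotes the null space. S-controllability (strong controllability) of $(E,A,B)$ means: $\operatorname{rank}([\,\lambda E-A\ \ B\,])=n$ for all $\lambda\in\mathbb{C}$, and $\operatorname{rank}([\,E\ \ AN_\infty\ \ B\,])=n$, where the columns of $N_\infty$ span $\mathcal{N}(E)$. The setting is pole assignment for $E\dot x=Ax+Bu$ by proportional plus derivative state feedback: one seeks $F,G\in\mathbb{R}^{m\times n}$, $X$ nonsingular, $P$ orthogonal, and $S,T$ upper quasi-triangular with $(A+BF)P=XS$, $(E+BG)P=XT$; eliminating $F,G$ leaves the conditions $Q_2^\top AP=Q_2^\top XS$, $Q_2^\top EP=Q_2^\top XT$. The prescribed spectrum contains $n-r$ infinite poles, which are assigned first, column by column. "$j$ infinite poles have already been assigned" means: $P_j=ZW_j$ with $W_j\in\mathbb{R}^{l\times j}$, $W_j^\top W_j=I_j$, the $j\times j$ leading principal submatrices of $S$ and $T$ are $S_j=I_j$ and $T_j=0$, and the matrix $Q_2^\top X_j$ is $Q_2^\top X_j=Q_2^\top AP_j$. (Only the product $Q_2^\top X_j$, not $X_j$ itself, is computed.) For $j=0$ the matrices $P_j,W_j,Q_2^\top X_j$ are empty. *)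

theory Defs
  imports Complex_Main "Jordan_Normal_Form.Matrix" "Jordan_Normal_Form.Matrix_Kernel"
    "Jordan_Normal_Form.DL_Rank"
begin

definition append_cols :: "'a::zero mat \<Rightarrow> 'a mat \<Rightarrow> 'a mat" (infixr \<open>@\<^sub>c\<close> 65) where
  "A @\<^sub>c B = four_block_mat A B (0\<^sub>m 0 (dim_col A)) (0\<^sub>m 0 (dim_col B))"

lemma carrier_append_cols [simp, intro]:
  "A \<in> carrier_mat nr nc1 \<Longrightarrow> B \<in> carrier_mat nr nc2 \<Longrightarrow> A @\<^sub>c B \<in> carrier_mat nr (nc1 + nc2)"
  unfolding append_cols_def by auto

abbreviation mat_rank :: "'a::field mat \<Rightarrow> nat" where
  "mat_rank A \<equiv> vec_space.rank (dim_row A) A"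

text \<open>The library predicate \<open>orthogonal_mat\<close> asks only for pairwise orthogonal nonzero columns,
  not for columns of unit length, so it is not used here.  For a square matrix the following
  predicate says that the matrix is orthogonal in the usual sense.\<close>

definition orthonormal_cols :: "real mat \<Rightarrow> bool" where
  "orthonormal_cols Z \<longleftrightarrow> Z\<^sup>T * Z = 1\<^sub>m (dim_col Z)"

definition cols_span_kernel :: "'a::field mat \<Rightarrow> 'a mat \<Rightarrow> bool" where
  "cols_span_kernel N A \<longleftrightarrow>
     dim_row N = dim_col A \<and> vec_space.col_space (dim_col A) N = mat_kernel A"

text \<open>The rank of \<open>[E, A N, B]\<close> is the same for every \<open>N\<close> whose columns span the kernel of \<open>E\<close>,
  and such an \<open>N\<close> always exists, so the choice of the quantifier for \<open>N\<close> is immaterial.  The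
  columns of \<open>N\<close> need not be linearly independent, and \<open>N\<close> may have no columns at all.\<close>

definition S_controllable :: "nat \<Rightarrow> real mat \<Rightarrow> real mat \<Rightarrow> real mat \<Rightarrow> bool" where
  "S_controllable n E A B \<longleftrightarrow>
     (\<forall>z::complex. mat_rank ((z \<cdot>\<^sub>m map_mat complex_of_real E - map_mat complex_of_real A)
                       @\<^sub>c map_mat complex_of_real B) = n) \<and>
     (\<exists>N. cols_span_kernel N E \<and> mat_rank (E @\<^sub>c (A * N) @\<^sub>c B) = n)"

definition QR_factorization ::
  "nat \<Rightarrow> nat \<Rightarrow> real mat \<Rightarrow> real mat \<Rightarrow> real mat \<Rightarrow> real mat \<Rightarrow> real mat \<Rightarrow> bool" where
  "QR_factorization n m B Q Q1 Q2 R \<longleftrightarrow>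
     Q \<in> carrier_mat n n \<and> Q1 \<in> carrier_mat n m \<and> Q2 \<in> carrier_mat n (n - m) \<and>
     R \<in> carrier_mat m m \<and>
     Q = Q1 @\<^sub>c Q2 \<and> orthonormal_cols Q \<and>
     upper_triangular R \<and> invertible_mat R \<and>
     B = Q * (R @\<^sub>r 0\<^sub>m (n - m) m) \<and> B = Q1 * R"

text \<open>\<open>P\<close>, \<open>X\<close> consist of the first \<open>j\<close> columns of the full matrices, and \<open>S\<close>, \<open>T\<close> are the leading
  principal \<open>j \<times> j\<close> blocks.  Only the product \<open>Q2\<^sup>T X\<close> is constrained; otherwise \<open>X\<close> is
  arbitrary.\<close>

definition infinite_poles_assigned ::
  "nat \<Rightarrow> nat \<Rightarrow> nat \<Rightarrow> real mat \<Rightarrow> real mat \<Rightarrow> real mat \<Rightarrow>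
   real mat \<Rightarrow> real mat \<Rightarrow> real mat \<Rightarrow> real mat \<Rightarrow> real mat \<Rightarrow> bool" where
  "infinite_poles_assigned n l j A Q2 Z P W S T X \<longleftrightarrow>
     P \<in> carrier_mat n j \<and> W \<in> carrier_mat l j \<and> X \<in> carrier_mat n j \<and>
     P = Z * W \<and> orthonormal_cols W \<and>
     S = 1\<^sub>m j \<and> T = 0\<^sub>m j j \<and>
     Q2\<^sup>T * X = Q2\<^sup>T * A * P"

definition pole_matrix :: "real mat \<Rightarrow> real mat \<Rightarrow> real mat \<Rightarrow> real mat \<Rightarrow> real mat \<Rightarrow> real mat" where
  "pole_matrix A Q2 Z W X =
     ((Q2\<^sup>T * A * Z) @\<^sub>c (- (Q2\<^sup>T)) @\<^sub>c (- (Q2\<^sup>T * X))) @\<^sub>r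
     (W\<^sup>T @\<^sub>c 0\<^sub>m (dim_col W) (dim_row Q2) @\<^sub>c 0\<^sub>m (dim_col W) (dim_col X))"

lemma pole_matrix_carrier:
  assumes "A \<in> carrier_mat n n" "Q2 \<in> carrier_mat n (n - m)" "Z \<in> carrier_mat n l"
    "W \<in> carrier_mat l j" "X \<in> carrier_mat n j"
  shows "pole_matrix A Q2 Z W X \<in> carrier_mat (n - m + j) (l + n + j)"
  using assms unfolding pole_matrix_def by (auto simp: append_cols_def append_rows_def)

end

theory Submission
  imports Defs
begin

text \<open>
  The matrix \<open>M\<close> has full row rank because \<open>Q\<^sub>2\<^sup>T\<close> and \<open>W\<^sub>j\<^sup>T\<close> have the right inverses \<open>Q\<^sub>2\<close> and
  \<open>W\<^sub>j\<close>; rank-nullity gives (a).  For (b), the kernel of \<open>[E B]\<close> has dimension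
  \<open>n + m - q \<ge> n - r > j\<close>, so it contains a nonzero \<open>(x, u)\<close> that satisfies the \<open>j\<close> further equations
  \<open>W\<^sub>j\<^sup>T Z\<^sup>T x = 0\<close>.  Multiplying \<open>E x + B u = 0\<close> by \<open>Q\<^sub>2\<^sup>T\<close> shows \<open>x = Z w\<close>, hence \<open>W\<^sub>j\<^sup>T w = 0\<close>, and
  \<open>w \<noteq> 0\<close> because \<open>B\<close> is injective.  The columns of \<open>- Q\<^sub>2\<^sup>T\<close> then absorb \<open>Q\<^sub>2\<^sup>T A Z w\<close>.
\<close>


section \<open>Block matrices and stacked vectors\<close>

lemma zero_mat_mult_vec:
  fixes v :: "'a::semiring_0 vec"
  shows "v \<in> carrier_vec nc \<Longrightarrow> 0\<^sub>m nr nc *\<^sub>v v = 0\<^sub>v nr"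
  by (intro eq_vecI) auto

lemma mat_mult_zero_vec:
  fixes A :: "'a::semiring_0 mat"
  shows "A \<in> carrier_mat nr nc \<Longrightarrow> A *\<^sub>v 0\<^sub>v nc = 0\<^sub>v nr"
  by (intro eq_vecI) auto

lemma append_cols_mult_vec:
  fixes A B :: "'a::comm_ring_1 mat"
  assumes A: "A \<in> carrier_mat nr nc1" and B: "B \<in> carrier_mat nr nc2"
    and u: "u \<in> carrier_vec nc1" and v: "v \<in> carrier_vec nc2"
  shows "(A @\<^sub>c B) *\<^sub>v (u @\<^sub>v v) = A *\<^sub>v u + B *\<^sub>v v"
proof -
  have "(A @\<^sub>c B) *\<^sub>v (u @\<^sub>v v) = (A *\<^sub>v u + B *\<^sub>v v) @\<^sub>v (0\<^sub>m 0 nc1 *\<^sub>v u + 0\<^sub>m 0 nc2 *\<^sub>v v)"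
    using four_block_mat_mult_vec[OF A B _ _ u v, of "0\<^sub>m 0 nc1" 0 "0\<^sub>m 0 nc2"] A B
    by (simp add: append_cols_def)
  \<comment> \<open>The lower blocks have no rows, so the appended second vector is empty.\<close>
  also have "\<dots> = A *\<^sub>v u + B *\<^sub>v v"
    using A B by (intro eq_vecI) auto
  finally show ?thesis .
qed

lemma append_cols_col:
  fixes A B :: "'a::comm_ring_1 mat"
  assumes A: "A \<in> carrier_mat nr nc1" and B: "B \<in> carrier_mat nr nc2"
  shows "j < nc1 \<Longrightarrow> col (A @\<^sub>c B) j = col A j"
    and "j < nc2 \<Longrightarrow> col (A @\<^sub>c B) (nc1 + j) = col B j"
  using A B by (auto intro!: eq_vecI simp: append_cols_def)

text \<open>All three identities are blocks of \<open>Q\<^sup>T * Q = 1\<close>, read off as inner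
  products of columns at indices shifted by \<open>a\<close>.\<close>

lemma orthonormal_cols_append:
  assumes Q1: "Q1 \<in> carrier_mat n a" and Q2: "Q2 \<in> carrier_mat n b"
    and Q: "orthonormal_cols (Q1 @\<^sub>c Q2)"
  shows "Q1\<^sup>T * Q1 = 1\<^sub>m a" "Q2\<^sup>T * Q2 = 1\<^sub>m b" "Q2\<^sup>T * Q1 = 0\<^sub>m b a"
proof -
  let ?Q = "Q1 @\<^sub>c Q2"
  have carr: "?Q \<in> carrier_mat n (a + b)" using Q1 Q2 by simp
  have ip: "col ?Q i \<bullet> col ?Q j = (if i = j then 1 else 0)" if "i < a + b" "j < a + b" for i j
  proof -
    have "(?Q\<^sup>T * ?Q) $$ (i,j) = (if i = j then 1 else 0)"
      using Q that carr unfolding orthonormal_cols_def by simp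
    then show ?thesis using that carr by simp
  qed
  note c = append_cols_col[OF Q1 Q2]
  show "Q1\<^sup>T * Q1 = 1\<^sub>m a"
    using Q1 ip by (intro eq_matI) (auto simp flip: c)
  show "Q2\<^sup>T * Q2 = 1\<^sub>m b"
    using Q2 ip by (intro eq_matI) (auto simp flip: c)
  show "Q2\<^sup>T * Q1 = 0\<^sub>m b a"
    using Q1 Q2 ip by (intro eq_matI) (auto simp flip: c)
qed

text \<open>Rank-nullity for the linear map given by \<open>A\<close>, once its abstract kernel and
  image are identified with \<open>mat_kernel A\<close> and the span of the columns.\<close>

lemma kernel_dim_plus_rank:
  fixes A :: "'a::field mat"
  assumes A: "A \<in> carrier_mat nr nc"
  shows "kernel_dim A + vec_space.rank nr A = nc"
proof -
  interpret kernel nr nc A by (unfold_locales, rule A)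
  interpret W: vec_space "TYPE('a)" nr .
  interpret T: linear_map class_ring NC.V W.V "\<lambda>v. A *\<^sub>v v"
  proof unfold_locales
    show "(*\<^sub>v) A \<in> LinearCombinations.module_hom class_ring NC.V W.V"
      using A mult_add_distrib_mat_vec[OF A] mult_mat_vec[OF A]
      by (simp add: LinearCombinations.module_hom_def)
  qed
  have ker: "T.kerT = mat_kernel A"
    using A by (auto simp: T.ker_def mat_kernel_def)
  have im: "T.imT = W.span (set (cols A))"
    unfolding T.im_def W.col_space_def[symmetric] W.col_space_eq[OF A] using A by auto
  have "W.rank A + dim = nc"
    using T.rank_nullity[OF NC.fin_dim] by (simp only: ker im W.rank_def NC.dim_is_n)
  then show ?thesis by (simp only: kernel_dim add.commute)
qed

text \<open>If \<open>H\<close> were injective on the kernel of \<open>A\<close>, the image would be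
  a subspace of \<open>k\<close>-space of dimension greater than \<open>k\<close>.\<close>

lemma kernel_meet_nonzero:
  fixes A H :: "'a::field mat"
  assumes A: "A \<in> carrier_mat nr nc" and H: "H \<in> carrier_mat k nc" and less: "k < kernel_dim A"
  obtains v where "v \<in> mat_kernel A" "H *\<^sub>v v = 0\<^sub>v k" "v \<noteq> 0\<^sub>v nc"
proof -
  interpret kernel nr nc A by (unfold_locales, rule A)
  interpret W: vec_space "TYPE('a)" k .
  have sub: "mat_kernel A \<subseteq> carrier_vec nc" by (rule mat_kernel_carrier[OF A])
  interpret T: linear_map class_ring VK W.V "\<lambda>v. H *\<^sub>v v"
  proof unfold_locales
    show "(*\<^sub>v) H \<in> LinearCombinations.module_hom class_ring VK W.V"
      using H sub mult_add_distrib_mat_vec[OF H] mult_mat_vec[OF H]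
      by (auto simp: LinearCombinations.module_hom_def subset_iff)
  qed
  have fd: "Ker.fin_dim"
    using kernel_basis_exists[OF A] unfolding Ker.fin_dim_def Ker.basis_def by auto
  have "\<not> inj_on (\<lambda>v. H *\<^sub>v v) (carrier VK)"
  proof
    assume inj: "inj_on (\<lambda>v. H *\<^sub>v v) (carrier VK)"
    have "vectorspace.dim class_ring (W.vs T.imT) = dim"
      using T.rank_nullity[OF fd] T.inj_imp_dim_ker0[OF inj] by simp
    \<comment> \<open>Comparing dimensions requires the image to be finite-dimensional. This is
      inherited from the kernel by viewing the map as a surjection onto its image.\<close>
    moreover have "vectorspace.fin_dim class_ring (W.vs T.imT)"
    proof (rule linear_map.surj_fin_dim)
      show "linear_map class_ring VK (W.vs T.imT) (\<lambda>v. H *\<^sub>v v)"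
      proof (intro linear_map.intro mod_hom.intro mod_hom_axioms.intro)
        show "vectorspace class_ring (W.vs T.imT)"
          by (rule W.subspace_is_vs[OF T.imT_is_subspace])
        then show "Module.module class_ring (W.vs T.imT)"
          by (rule vectorspace.axioms(1))
        show "(*\<^sub>v) H \<in> LinearCombinations.module_hom class_ring VK (W.vs T.imT)"
          using T.f_hom by (auto simp: LinearCombinations.module_hom_def T.im_def)
      qed (rule Ker.vectorspace_axioms Ker.module_axioms)+
    qed (use fd in \<open>auto simp: T.im_def\<close>)
    then have "vectorspace.dim class_ring (W.vs T.imT) \<le> k"
      using W.subspace_dim[OF T.imT_is_subspace W.fin_dim] W.dim_is_n by simp
    ultimately show False using less by simp
  qed
  then have "T.kerT \<noteq> {0\<^sub>v nc}"
    using T.Ke0_iff_inj by simp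
  moreover have "0\<^sub>v nc \<in> T.kerT"
    using H A unfolding T.ker_def by (auto simp: mat_kernel)
  ultimately obtain v where "v \<in> T.kerT" "v \<noteq> 0\<^sub>v nc" by blast
  then show ?thesis using that[of v] by (simp add: T.ker_def)
qed

section \<open>Solving linear systems with the pole matrix\<close>

lemma orthonormal_cols_mult_vec:
  assumes "W \<in> carrier_mat l j" "orthonormal_cols W" "b \<in> carrier_vec j"
  shows "W\<^sup>T *\<^sub>v (W *\<^sub>v b) = b"
  using assms assoc_mult_mat_vec[of "W\<^sup>T" j l W j b] unfolding orthonormal_cols_def by simp

lemma pole_matrix_mult_vec:
  assumes A: "A \<in> carrier_mat n n" and Q2: "Q2 \<in> carrier_mat n k" and Z: "Z \<in> carrier_mat n l"
    and W: "W \<in> carrier_mat l j" and X: "X \<in> carrier_mat n j"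
    and w: "w \<in> carrier_vec l" and x: "x \<in> carrier_vec n"
  shows "pole_matrix A Q2 Z W X *\<^sub>v (w @\<^sub>v x @\<^sub>v 0\<^sub>v j) =
    (Q2\<^sup>T * A * Z *\<^sub>v w - Q2\<^sup>T *\<^sub>v x) @\<^sub>v (W\<^sup>T *\<^sub>v w)"
proof -
  have v: "w @\<^sub>v x @\<^sub>v 0\<^sub>v j \<in> carrier_vec (l + (n + j))" using w x by simp
  have c: "Q2\<^sup>T * A * Z \<in> carrier_mat k l" "- (Q2\<^sup>T) \<in> carrier_mat k n" "- (Q2\<^sup>T * X) \<in> carrier_mat k j"
    using assms by auto
  have W': "W\<^sup>T \<in> carrier_mat j l" using W by simp
  have Q: "- (Q2\<^sup>T) *\<^sub>v x = - (Q2\<^sup>T *\<^sub>v x)" using Q2 x by (intro eq_vecI) auto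
  have M: "pole_matrix A Q2 Z W X = ((Q2\<^sup>T * A * Z) @\<^sub>c (- (Q2\<^sup>T)) @\<^sub>c (- (Q2\<^sup>T * X))) @\<^sub>r
     (W\<^sup>T @\<^sub>c 0\<^sub>m j n @\<^sub>c 0\<^sub>m j j)"
    using W Q2 X unfolding pole_matrix_def by simp
  have top: "((Q2\<^sup>T * A * Z) @\<^sub>c (- (Q2\<^sup>T)) @\<^sub>c (- (Q2\<^sup>T * X))) *\<^sub>v (w @\<^sub>v x @\<^sub>v 0\<^sub>v j)
      = Q2\<^sup>T * A * Z *\<^sub>v w - Q2\<^sup>T *\<^sub>v x"
  proof -
    have "((Q2\<^sup>T * A * Z) @\<^sub>c (- (Q2\<^sup>T)) @\<^sub>c (- (Q2\<^sup>T * X))) *\<^sub>v (w @\<^sub>v x @\<^sub>v 0\<^sub>v j)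
      = Q2\<^sup>T * A * Z *\<^sub>v w + (- (Q2\<^sup>T) *\<^sub>v x + - (Q2\<^sup>T * X) *\<^sub>v 0\<^sub>v j)"
      using append_cols_mult_vec[OF c(1) carrier_append_cols[OF c(2,3)] w, of "x @\<^sub>v 0\<^sub>v j"]
        append_cols_mult_vec[OF c(2,3) x, of "0\<^sub>v j"] x by simp
    also have "- (Q2\<^sup>T * X) *\<^sub>v 0\<^sub>v j = 0\<^sub>v k"
      using mat_mult_zero_vec[OF c(3)] .
    also have "Q2\<^sup>T * A * Z *\<^sub>v w + (- (Q2\<^sup>T) *\<^sub>v x + 0\<^sub>v k) = Q2\<^sup>T * A * Z *\<^sub>v w - Q2\<^sup>T *\<^sub>v x"
      unfolding Q using Q2 x c(1) w by (intro eq_vecI) auto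
    finally show ?thesis .
  qed
  have bot: "(W\<^sup>T @\<^sub>c 0\<^sub>m j n @\<^sub>c 0\<^sub>m j j) *\<^sub>v (w @\<^sub>v x @\<^sub>v 0\<^sub>v j) = W\<^sup>T *\<^sub>v w"
    using append_cols_mult_vec[OF W' carrier_append_cols[of "0\<^sub>m j n" j n "0\<^sub>m j j" j] w, of "x @\<^sub>v 0\<^sub>v j"]
      append_cols_mult_vec[of "0\<^sub>m j n" j n "0\<^sub>m j j" j x "0\<^sub>v j"]
      zero_mat_mult_vec[OF x, of j] mat_mult_zero_vec[of "0\<^sub>m j j :: real mat" j j]
      mult_mat_vec_carrier[OF W' w] x by simp
  have "(Q2\<^sup>T * A * Z) @\<^sub>c (- (Q2\<^sup>T)) @\<^sub>c (- (Q2\<^sup>T * X)) \<in> carrier_mat k (l + (n + j))"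
    using c by blast
  moreover have "W\<^sup>T @\<^sub>c 0\<^sub>m j n @\<^sub>c 0\<^sub>m j j \<in> carrier_mat j (l + (n + j))"
    using W' by (intro carrier_append_cols) auto
  ultimately show ?thesis
    using mat_mult_append[OF _ _ v] by (simp only: M top bot)
qed

text \<open>Since \<open>Q2\<close> is a right inverse of \<open>Q2\<^sup>T\<close>, the choice
  \<open>x = Q2 (b - a)\<close> with \<open>b = Q2\<^sup>T A Z w\<close> turns the top block into
  \<open>b - (b - a) = a\<close>. An arbitrary \<open>a\<close> gives surjectivity,
  \<open>a = 0\<close> a kernel vector with prescribed \<open>w\<close>.\<close>

lemma pole_matrix_solve:
  assumes A: "A \<in> carrier_mat n n" and Q2: "Q2 \<in> carrier_mat n k" and Z: "Z \<in> carrier_mat n l"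
    and W: "W \<in> carrier_mat l j" and X: "X \<in> carrier_mat n j"
    and orth: "orthonormal_cols Q2"
    and w: "w \<in> carrier_vec l" and a: "a \<in> carrier_vec k"
  obtains x where "x \<in> carrier_vec n"
    "pole_matrix A Q2 Z W X *\<^sub>v (w @\<^sub>v x @\<^sub>v 0\<^sub>v j) = a @\<^sub>v (W\<^sup>T *\<^sub>v w)"
proof -
  define b where "b = Q2\<^sup>T * A * Z *\<^sub>v w"
  have b: "b \<in> carrier_vec k" using Q2 A Z unfolding b_def
    by (intro mult_mat_vec_carrier[OF _ w] mult_carrier_mat) auto
  have x: "Q2 *\<^sub>v (b - a) \<in> carrier_vec n" using Q2 a b by auto
  have ba: "b - a \<in> carrier_vec k" using a b by simp
  have "b - (b - a) = a" using a b by (intro eq_vecI) auto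
  then have "pole_matrix A Q2 Z W X *\<^sub>v (w @\<^sub>v Q2 *\<^sub>v (b - a) @\<^sub>v 0\<^sub>v j) = a @\<^sub>v (W\<^sup>T *\<^sub>v w)"
    unfolding pole_matrix_mult_vec[OF A Q2 Z W X w x] orthonormal_cols_mult_vec[OF Q2 orth ba]
      b_def[symmetric] by (rule arg_cong)
  then show ?thesis by (rule that[OF x])
qed

lemma kernel_dim_surj:
  fixes M :: "'a::field mat"
  assumes M: "M \<in> carrier_mat nr nc"
    and surj: "\<And>y. y \<in> carrier_vec nr \<Longrightarrow> \<exists>x \<in> carrier_vec nc. M *\<^sub>v x = y"
  shows "kernel_dim M + nr = nc"
proof -
  interpret W: vec_space "TYPE('a)" nr .
  have "W.col_space M = carrier_vec nr"
  proof
    show "W.col_space M \<subseteq> carrier_vec nr"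
      unfolding W.col_space_eq[OF M] using M by blast
    show "carrier_vec nr \<subseteq> W.col_space M"
      unfolding W.col_space_eq[OF M] using M surj by blast
  qed
  then have span: "W.span (set (cols M)) = carrier_vec nr"
    unfolding W.col_space_def .
  \<comment> \<open>The rank is the dimension of the span as a space of its own; here that space is
    the ambient one.\<close>
  have vs: "module_vec TYPE('a) nr\<lparr>carrier := carrier_vec nr\<rparr> = module_vec TYPE('a) nr"
    unfolding module_vec_def by simp
  have "W.rank M = nr"
    unfolding W.rank_def span vs by (rule W.dim_is_n)
  then show ?thesis using kernel_dim_plus_rank[OF M] by linarith
qed

theorem theorem5:
  fixes n m l q j :: nat and r :: int
    and E A B Q Q1 Q2 R Z P W S T X :: "real mat"
  assumes E: "E \<in> carrier_mat n n" and A: "A \<in> carrier_mat n n" and B: "B \<in> carrier_mat n m"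
    and full_rank: "mat_rank B = m"
    and controllable: "S_controllable n E A B"
    and QR: "QR_factorization n m B Q Q1 Q2 R"
    and q: "q = mat_rank (E @\<^sub>c B)"
    and r: "int q - int m \<le> r" "r \<le> int q"
    and l: "l = n - mat_rank (Q2\<^sup>T * E)"
    and Z: "Z \<in> carrier_mat n l" "orthonormal_cols Z" "cols_span_kernel Z (Q2\<^sup>T * E)"
    and j: "int j \<le> int n - r - 1"
    and assigned: "infinite_poles_assigned n l j A Q2 Z P W S T X"
  shows "kernel_dim (pole_matrix A Q2 Z W X) = m + l \<and>
    (\<exists>w \<in> carrier_vec l. \<exists>x \<in> carrier_vec n. \<exists>v \<in> carrier_vec j.
       w \<noteq> 0\<^sub>v l \<and> w @\<^sub>v x @\<^sub>v v \<in> mat_kernel (pole_matrix A Q2 Z W X))"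
proof -
  let ?M = "pole_matrix A Q2 Z W X"
  from QR have Q: "Q1 @\<^sub>c Q2 \<in> carrier_mat n n" "orthonormal_cols (Q1 @\<^sub>c Q2)"
    and Q1: "Q1 \<in> carrier_mat n m" and Q2: "Q2 \<in> carrier_mat n (n - m)"
    and R: "R \<in> carrier_mat m m" "invertible_mat R" and BQR: "B = Q1 * R"
    unfolding QR_factorization_def by auto
  \<comment> \<open>Subtraction truncates at zero, so \<open>m + (n - m) = n\<close> carries
    information.\<close>
  have mn: "m \<le> n" using carrier_append_cols[OF Q1 Q2] Q(1) by auto
  note orth = orthonormal_cols_append[OF Q1 Q2 Q(2)]
  have orthQ2: "orthonormal_cols Q2" using orth(2) Q2 unfolding orthonormal_cols_def by simp
  from assigned have W: "W \<in> carrier_mat l j" "orthonormal_cols W" and X: "X \<in> carrier_mat n j"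
    unfolding infinite_poles_assigned_def by auto
  have M: "?M \<in> carrier_mat (n - m + j) (l + n + j)"
    by (rule pole_matrix_carrier[OF A Q2 Z(1) W(1) X])
  note solve = pole_matrix_solve[OF A Q2 Z(1) W(1) X orthQ2]

  \<comment> \<open>Dimension of the kernel of \<open>?M\<close>\<close>
  have "kernel_dim ?M + (n - m + j) = l + n + j"
  proof (rule kernel_dim_surj[OF M])
    fix y :: "real vec" assume "y \<in> carrier_vec (n - m + j)"
    then have y: "y = vec_first y (n - m) @\<^sub>v vec_last y j" by simp
    \<comment> \<open>\<open>W\<close> is a right inverse of \<open>W\<^sup>T\<close>, so this
      vector produces the required bottom block.\<close>
    have w: "W *\<^sub>v vec_last y j \<in> carrier_vec l" using W(1) by simp
    obtain x where x: "x \<in> carrier_vec n" and eq: "?M *\<^sub>v (W *\<^sub>v vec_last y j @\<^sub>v x @\<^sub>v 0\<^sub>v j)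
        = vec_first y (n - m) @\<^sub>v (W\<^sup>T *\<^sub>v (W *\<^sub>v vec_last y j))"
      by (rule solve[OF w vec_first_carrier])
    have "?M *\<^sub>v (W *\<^sub>v vec_last y j @\<^sub>v x @\<^sub>v 0\<^sub>v j) = y"
      unfolding eq orthonormal_cols_mult_vec[OF W vec_last_carrier] using y by simp
    moreover have "W *\<^sub>v vec_last y j @\<^sub>v x @\<^sub>v 0\<^sub>v j \<in> carrier_vec (l + n + j)"
      using w x by (simp add: add.assoc)
    ultimately show "\<exists>x\<in>carrier_vec (l + n + j). ?M *\<^sub>v x = y" by blast
  qed
  then have a: "kernel_dim ?M = m + l" using mn by simp

  \<comment> \<open>A kernel vector with nonzero leading block\<close>
  have EB: "E @\<^sub>c B \<in> carrier_mat n (n + m)" using E B by simp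
  have "kernel_dim (E @\<^sub>c B) + q = n + m"
    using kernel_dim_plus_rank[OF EB] EB q by simp
  then have less: "j < kernel_dim (E @\<^sub>c B)" using r j by linarith
  \<comment> \<open>The zero block leaves \<open>u\<close> free: the \<open>j\<close> extra
    equations restrict only \<open>x\<close>.\<close>
  let ?H = "(W\<^sup>T * Z\<^sup>T) @\<^sub>c 0\<^sub>m j m"
  have WZ: "W\<^sup>T * Z\<^sup>T \<in> carrier_mat j n" using W(1) Z(1) by simp
  have H: "?H \<in> carrier_mat j (n + m)" using WZ by simp
  obtain y where y: "y \<in> mat_kernel (E @\<^sub>c B)" "?H *\<^sub>v y = 0\<^sub>v j" "y \<noteq> 0\<^sub>v (n + m)"
    by (rule kernel_meet_nonzero[OF EB H less])
  note yk = mat_kernelD[OF EB y(1)]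
  define x u where "x = vec_first y n" and "u = vec_last y m"
  have x: "x \<in> carrier_vec n" and u: "u \<in> carrier_vec m" and yxu: "y = x @\<^sub>v u"
    using yk(1) unfolding x_def u_def by simp_all
  have ExBu: "E *\<^sub>v x + B *\<^sub>v u = 0\<^sub>v n"
    using yk(2) append_cols_mult_vec[OF E B x u] unfolding yxu by simp
  have Hx: "W\<^sup>T * Z\<^sup>T *\<^sub>v x = 0\<^sub>v j"
    using y(2) append_cols_mult_vec[OF WZ zero_carrier_mat x u]
      mult_mat_vec_carrier[OF WZ x] zero_mat_mult_vec[OF u, of j]
    unfolding yxu by simp
  have Q2E: "Q2\<^sup>T * E \<in> carrier_mat (n - m) n" using Q2 E by simp
  \<comment> \<open>The range of \<open>B = Q1 R\<close> is orthogonal to the columns of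
    \<open>Q2\<close>.\<close>
  have Q2B: "Q2\<^sup>T *\<^sub>v (B *\<^sub>v u) = 0\<^sub>v (n - m)"
  proof -
    have "Q2\<^sup>T * B = Q2\<^sup>T * Q1 * R"
      unfolding BQR using Q2 Q1 R by (simp add: assoc_mult_mat[of _ "n - m" n _ m _ m])
    also have "\<dots> = 0\<^sub>m (n - m) m" unfolding orth(3) using R by simp
    finally show ?thesis
      using assoc_mult_mat_vec[of "Q2\<^sup>T" "n - m" n B m u] zero_mat_mult_vec[OF u] Q2 B u by simp
  qed
  have "Q2\<^sup>T * E *\<^sub>v x = Q2\<^sup>T *\<^sub>v (E *\<^sub>v x + B *\<^sub>v u)"
    using Q2 E B x u Q2B by (simp add: mult_add_distrib_mat_vec[of _ "n - m" n])
  also have "\<dots> = 0\<^sub>v (n - m)" unfolding ExBu using Q2 by (intro mat_mult_zero_vec) simp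
  finally have "x \<in> mat_kernel (Q2\<^sup>T * E)" by (rule mat_kernelI[OF Q2E x])
  then have "x \<in> vec_space.col_space n Z"
    using Z(3) E unfolding cols_span_kernel_def by simp
  then obtain w where w: "w \<in> carrier_vec l" and xw: "x = Z *\<^sub>v w"
    using Z(1) unfolding vec_space.col_space_eq[OF Z(1)] by auto
  \<comment> \<open>Orthonormality of \<open>Z\<close> recovers \<open>w\<close> as
    \<open>Z\<^sup>T x\<close>, so the extra equations on \<open>x\<close> become
    \<open>W\<^sup>T w = 0\<close>.\<close>
  have "W\<^sup>T *\<^sub>v w = W\<^sup>T *\<^sub>v (Z\<^sup>T *\<^sub>v x)"
    unfolding xw orthonormal_cols_mult_vec[OF Z(1,2) w] ..
  then have Ww: "W\<^sup>T *\<^sub>v w = 0\<^sub>v j"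
    using Hx assoc_mult_mat_vec[of "W\<^sup>T" j l "Z\<^sup>T" n x] W(1) Z(1) x by simp
  have w0: "w \<noteq> 0\<^sub>v l"
  proof
    assume "w = 0\<^sub>v l"
    then have x0: "x = 0\<^sub>v n" unfolding xw using mat_mult_zero_vec[OF Z(1)] by simp
    then have Bu: "B *\<^sub>v u = 0\<^sub>v n" using ExBu mat_mult_zero_vec[OF E] B u by simp
    \<comment> \<open>\<open>R' Q1\<^sup>T\<close> will be a left inverse of \<open>B\<close>, so
      \<open>B u = 0\<close> forces \<open>u = 0\<close>, contradicting
      \<open>y \<noteq> 0\<close>.\<close>
    obtain R' where R': "R' * R = 1\<^sub>m m" "R' \<in> carrier_mat m m"
    proof -
      obtain R' where R': "R * R' = 1\<^sub>m m" "R' * R = 1\<^sub>m (dim_row R')"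
        using R unfolding invertible_mat_def inverts_mat_def by auto
      from arg_cong[OF R'(1), of dim_col] arg_cong[OF R'(2), of dim_col] R(1)
      have "R' \<in> carrier_mat m m" by auto
      with R' show ?thesis by (intro that) auto
    qed
    have "R' * Q1\<^sup>T * B = R' * (Q1\<^sup>T * Q1) * R"
      unfolding BQR using R' R Q1
      by (simp add: assoc_mult_mat[of _ m m _ n _ m] assoc_mult_mat[of _ m n _ m _ m]
        assoc_mult_mat[of _ m m _ m _ m])
    also have "\<dots> = 1\<^sub>m m" unfolding orth(1) using R' by simp
    finally have "u = R' * Q1\<^sup>T * B *\<^sub>v u" using u by simp
    also have "\<dots> = R' * Q1\<^sup>T *\<^sub>v (B *\<^sub>v u)"
      by (rule assoc_mult_mat_vec[of _ m n _ m]) (use R' Q1 B u in auto)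
    also have "\<dots> = 0\<^sub>v m" unfolding Bu using R' Q1 by (intro mat_mult_zero_vec) auto
    finally show False using x0 y(3) unfolding yxu by auto
  qed
  \<comment> \<open>The earlier \<open>x\<close> served only to find \<open>w\<close>; the middle
    block of the kernel vector is a new vector, chosen to cancel
    \<open>Q2\<^sup>T A Z w\<close>.\<close>
  obtain x' where x': "x' \<in> carrier_vec n"
    "?M *\<^sub>v (w @\<^sub>v x' @\<^sub>v 0\<^sub>v j) = 0\<^sub>v (n - m) @\<^sub>v (W\<^sup>T *\<^sub>v w)"
    by (rule solve[OF w zero_carrier_vec])
  have "w @\<^sub>v x' @\<^sub>v 0\<^sub>v j \<in> mat_kernel ?M"
    by (rule mat_kernelI[OF M]) (use w x' Ww in \<open>auto simp: add.assoc\<close>)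
  with w0 have "w \<noteq> 0\<^sub>v l \<and> w @\<^sub>v x' @\<^sub>v 0\<^sub>v j \<in> mat_kernel ?M" by (rule conjI)
  then show ?thesis
    by (intro conjI[OF a]) (rule bexI[OF _ w], rule bexI[OF _ x'(1)], rule bexI[of _ "0\<^sub>v j"], auto)
qed

end
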